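(* Let $x\in\mathbb{R}$ with $x\geq 2$. Then $$P_a(x)\,P_b(x)>P_{a+b}(x)$$ for all positive integers $a$ and $b$ satisfying $a+b\geq 12$.
   Context: Let $\sigma_2(n)=\sum_{d\mid n}d^2$. The polynomials $P_n(x)$ are defined by $P_0(x)=1$ and $P_n(x)=\frac{x}{n}\sum_{k=1}^n\sigma_2(k)\,P_{n-k}(x)$ for $n\geq1$; equivalently $\sum_{n\ge0}P_n(x)q^n=\prod_{n\ge1}(1-q^n)^{-nx}$. *)

theory Defs
  imports "HOL-Analysis.Analysis" "HOL-Computational_Algebra.Polynomial"
begin

(* Only used for n >= 1; for n = 0 the index set is infinite and the sum is 0. *)
definition sigma2 :: "nat \<Rightarrow> nat" where
  "sigma2 n = (\<Sum>d | d dvd n. d ^ 2)"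

fun P :: "nat \<Rightarrow> real poly" where
  "P 0 = 1"
| "P (Suc n) =
     smult (1 / real (Suc n)) (monom 1 1 * (\<Sum>k=1..Suc n. smult (real (sigma2 k)) (P (Suc n - k))))"

lemma poly_P_rec:
  assumes "n \<ge> 1"
  shows "poly (P n) x = x / real n * (\<Sum>k=1..n. real (sigma2 k) * poly (P (n - k)) x)"
proof -
  obtain m where "n = Suc m"
    using assms by (cases n) auto
  then show ?thesis
    by (simp add: poly_sum poly_monom del: sum.cl_ivl_Suc of_nat_Suc)
qed

end

theory Submission
  imports Defs
begin

text \<open>
  Fix \<open>x \<ge> 2\<close> and write \<open>p n\<close> for \<open>P\<^sub>n(x)\<close> and
  \<open>D(a, b) = p a * p b - p (a + b)\<close>. Inserting the recurrence for \<open>p a\<close> and for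
  \<open>p (a + b)\<close> gives
  \<open>a * D(a, b) = x * (\<Sum>i<a. \<sigma>\<^sub>2(a - i) * D(i, b)) + gap(a + b, b)\<close>
  with \<open>gap(n, b) = b * p n - x * (\<Sum>j<b. \<sigma>\<^sub>2(n - j) * p j)\<close>.
  For \<open>a \<ge> b\<close> the gap is positive because \<open>p\<close> grows fast, so \<open>D(a, b) > 0\<close> follows by
  induction on \<open>a + b\<close>. The induction also covers \<open>a, b \<ge> 2\<close> with \<open>a + b < 12\<close>, hence the only
  terms \<open>D(i, b)\<close> that can be negative are \<open>D(1, j)\<close> and \<open>D(j, 1)\<close> with \<open>1 \<le> j \<le> 10\<close>, and the
  gap outweighs them. For \<open>a + b \<le> 22\<close> this is checked on the coefficients of polynomials in
  \<open>y = x - 2\<close>; for \<open>a + b \<ge> 23\<close> it follows from \<open>p (j + m) \<ge> 2 * x * m\<^sup>2 * p j\<close>, valid for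
  \<open>m \<ge> 13\<close> and \<open>j + 2 \<le> m\<close>.
\<close>

section \<open>The divisor sum\<close>

declare P.simps(2) [simp del]

lemma sigma2_ge_square: "n \<ge> 1 \<Longrightarrow> n ^ 2 \<le> sigma2 n"
  unfolding sigma2_def by (rule member_le_sum) auto

text \<open>For \<open>d \<ge> 2\<close>, \<open>1 / d ^ 2\<close> is at most the telescoping
  difference \<open>1 / (d - 1) - 1 / d\<close>.\<close>

lemma sum_inverse_squares_le:
  "n \<ge> 1 \<Longrightarrow> (\<Sum>d=1..n. 1 / real d ^ 2) \<le> 2 - 1 / real n"
proof (induction n rule: dec_induct)
  case (step n)
  have "1 / real (Suc n) ^ 2 \<le> 1 / real n - 1 / real (Suc n)"
    using step.hyps(1) by (simp add: divide_simps power2_eq_square)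
  with step.IH show ?case by simp
qed simp

text \<open>Pairing \<open>d\<close> with \<open>n div d\<close> writes the sum as
  \<open>n ^ 2\<close> times a sum of inverse squares, which stays below 2.\<close>

lemma sigma2_less:
  assumes "n \<ge> 1"
  shows "real (sigma2 n) < 2 * real n ^ 2"
proof -
  have "real (sigma2 n) = (\<Sum>d | d dvd n. real (n div d) ^ 2)"
    unfolding sigma2_def of_nat_sum of_nat_power
    by (rule sum.reindex_bij_witness[of _ "\<lambda>d. n div d" "\<lambda>d. n div d"])
       (use assms in \<open>auto simp: dvd_div_eq_mult elim!: dvdE\<close>)
  also have "\<dots> = (\<Sum>d | d dvd n. real n ^ 2 * (1 / real d ^ 2))"
    by (intro sum.cong) (auto simp: real_of_nat_div power_divide)
  also have "\<dots> = real n ^ 2 * (\<Sum>d | d dvd n. 1 / real d ^ 2)"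
    by (simp add: sum_distrib_left)
  also have "\<dots> \<le> real n ^ 2 * (\<Sum>d=1..n. 1 / real d ^ 2)"
    using assms by (intro mult_left_mono sum_mono2) (auto dest: dvd_imp_le intro: Nat.gr0I)
  also have "\<dots> \<le> real n ^ 2 * (2 - 1 / real n)"
    using assms by (intro mult_left_mono sum_inverse_squares_le) auto
  also have "\<dots> < 2 * real n ^ 2"
    using assms by (simp add: algebra_simps)
  finally show ?thesis .
qed

text \<open>Entry \<open>i\<close> belongs to the argument \<open>i + 1\<close>. The longest
  convolution, with \<open>growth 70 29\<close>, takes thirty entries.\<close>

definition sigma2_list :: "int list" where
  "sigma2_list = [1, 5, 10, 21, 26, 50, 50, 85, 91, 130, 122, 210, 170, 250, 260, 341, 290, 455,
     362, 546, 500, 610, 530, 850, 651, 850, 820, 1050, 842, 1300]"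

text \<open>An executable form, so that \<open>code_simp\<close> can confirm the table.\<close>

lemma sigma2_conv_sum_list:
  assumes "n \<ge> 1"
  shows "int (sigma2 n) = (\<Sum>d\<leftarrow>[1..int n]. if int n mod d = 0 then d * d else 0)"
proof -
  have "int (sigma2 n) = (\<Sum>d | d \<in> {1..int n} \<and> d dvd int n. d * d)"
    unfolding sigma2_def of_nat_sum using assms
    by (intro sum.reindex_bij_witness[of _ nat int])
       (auto simp: power2_eq_square nat_dvd_iff dest: dvd_imp_le intro: Nat.gr0I)
  also have "\<dots> = (\<Sum>d\<in>{1..int n}. if int n mod d = 0 then d * d else 0)"
    by (subst sum.inter_filter[symmetric]) (simp_all add: dvd_eq_mod_eq_0)
  also have "\<dots> = (\<Sum>d\<leftarrow>[1..int n]. if int n mod d = 0 then d * d else 0)"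
    by (simp only: interv_sum_list_conv_sum_set_int set_upto)
  finally show ?thesis .
qed

lemma sigma2_list_conv_map:
  "sigma2_list = map (\<lambda>n. \<Sum>d\<leftarrow>[1..n]. if n mod d = 0 then d * d else 0) [1..30]"
  by code_simp

lemma length_sigma2_list: "length sigma2_list = 30"
  by (simp add: sigma2_list_def)

lemma sigma2_list_nth: "i < 30 \<Longrightarrow> sigma2_list ! i = int (sigma2 (Suc i))"
  unfolding sigma2_list_conv_map by (simp add: sigma2_conv_sum_list nth_upto)

section \<open>Polynomials in \<open>y = x - 2\<close> with integer coefficients\<close>

text \<open>
  A polynomial is the list of its coefficients in \<open>y\<close>, constant term first, so that
  \<open>mult_x\<close> multiplies by \<open>y + 2\<close>.
\<close>
fun list_add :: "int list \<Rightarrow> int list \<Rightarrow> int list" where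
  "list_add [] ys = ys"
| "list_add xs [] = xs"
| "list_add (x # xs) (y # ys) = (x + y) # list_add xs ys"

fun list_scale :: "int \<Rightarrow> int list \<Rightarrow> int list" where
  "list_scale c [] = []"
| "list_scale c (x # xs) = c * x # list_scale c xs"

definition mult_x :: "int list \<Rightarrow> int list" where
  "mult_x xs = list_add (list_scale 2 xs) (0 # xs)"

fun lin_comb :: "int list \<Rightarrow> int list list \<Rightarrow> int list" where
  "lin_comb (c # cs) (xs # xss) = list_add (list_scale c xs) (lin_comb cs xss)"
| "lin_comb _ _ = []"

fun falling_comb :: "int \<Rightarrow> int list \<Rightarrow> int list list \<Rightarrow> int list" where
  "falling_comb m (c # cs) (xs # xss) =
     list_add (list_scale c xs) (list_scale m (falling_comb (m - 1) cs xss))"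
| "falling_comb _ _ _ = []"

text \<open>
  The rows are \<open>n! * P n, \<dots>, 0! * P 0\<close>, in descending order; the factors \<open>n! / i!\<close> that the scaling
  puts into the recurrence are supplied Horner-style by \<open>falling_comb\<close>. The step is a separate
  function because \<open>code_simp\<close> would otherwise evaluate the repeated argument twice at each level.
\<close>
definition add_row :: "nat \<Rightarrow> int list list \<Rightarrow> int list list" where
  "add_row n xss = mult_x (falling_comb (int n) sigma2_list xss) # xss"

fun fact_P_rows :: "nat \<Rightarrow> int list list" where
  "fact_P_rows 0 = [[1]]"
| "fact_P_rows (Suc n) = add_row n (fact_P_rows n)"

text \<open>The falling factorial accumulated in \<open>c\<close> brings all rows to one common
  factorial.\<close>

fun rescale :: "int \<Rightarrow> int \<Rightarrow> int list list \<Rightarrow> int list list" where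
  "rescale c m [] = []"
| "rescale c m (xs # xss) = list_scale c xs # rescale (c * m) (m - 1) xss"

text \<open>Row \<open>n\<close> of the table is \<open>22! * P n\<close>, in ascending order.\<close>
definition P_table :: "int list list" where
  "P_table = rev (rescale 1 22 (fact_P_rows 22))"

section \<open>Coefficientwise positivity checks\<close>

fun list_pos :: "int list \<Rightarrow> bool" where
  "list_pos [] = False"
| "list_pos (x # xs) = (0 < x \<and> list_all (\<lambda>c. 0 \<le> c) xs)"

definition excess_one_coeffs :: "int list list \<Rightarrow> nat \<Rightarrow> int list" where
  "excess_one_coeffs t i = list_add (mult_x (t ! i)) (list_scale (- 1) (t ! Suc i))"

definition gap_coeffs :: "int list list \<Rightarrow> nat \<Rightarrow> nat \<Rightarrow> int list" where
  "gap_coeffs t n b = list_add (list_scale (int b) (t ! n))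
     (list_scale (- 1) (mult_x (lin_comb (take b (rev (take n sigma2_list))) t)))"

text \<open>With \<open>a = n - b\<close>, the correction to the gap is the \<open>D(1, b)\<close>
  term of the recurrence; its weight \<open>sigma2 (a - 1)\<close> sits at index
  \<open>n - b - 2\<close>.\<close>

definition check_ge2 :: "int list list \<Rightarrow> nat \<Rightarrow> nat \<Rightarrow> bool" where
  "check_ge2 t n b = list_pos (list_add (gap_coeffs t n b)
      (mult_x (list_scale (sigma2_list ! (n - b - 2)) (excess_one_coeffs t b))))"

text \<open>For \<open>b = 1\<close> the ten terms \<open>D(i, 1)\<close> with
  \<open>1 \<le> i \<le> 10\<close> are added, weighted by
  \<open>sigma2 (n - 1 - i)\<close>.\<close>

definition check_1 :: "int list list \<Rightarrow> nat \<Rightarrow> bool" where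
  "check_1 t n = list_pos (list_add (gap_coeffs t n 1)
      (mult_x (lin_comb (take 10 (rev (take (n - 2) sigma2_list))) (map (excess_one_coeffs t) [1..<11]))))"

text \<open>\<open>c\<close> is the scaling factor of the table.\<close>
definition check_all :: "int \<Rightarrow> int list list \<Rightarrow> bool" where
  "check_all c t \<longleftrightarrow>
     list_all (\<lambda>n. list_all (check_ge2 t n) [2..<Suc (n div 2)]) [4..<23] \<and>
     list_all (check_1 t) [12..<23] \<and>
     list_all (\<lambda>i. list_all (\<lambda>a. 0 \<le> a) (list_add (excess_one_coeffs t i) [180 * c, 90 * c])) [1..<11] \<and>
     list_all (\<lambda>a. 0 \<le> a) (list_add (t ! 10) [- 5380 * c, - 2690 * c])"

text \<open>
  Entry \<open>h - i\<close> of \<open>growth c h\<close> bounds \<open>p (j + i) / p j\<close> from below for all \<open>x \<ge> 2\<close> and \<open>j \<le> c\<close>: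
  it is the recurrence with \<open>x / (j + i)\<close> replaced by \<open>2 / (c + i)\<close> and rounded down.
\<close>
definition add_growth :: "nat \<Rightarrow> int list \<Rightarrow> int list" where
  "add_growth d l = max 1 (2 * (\<Sum>(a, b)\<leftarrow>zip sigma2_list l. a * b) div int d) # l"

fun growth :: "nat \<Rightarrow> nat \<Rightarrow> int list" where
  "growth c 0 = [1]"
| "growth c (Suc h) = add_growth (c + Suc h) (growth c h)"

text \<open>The right-hand side \<open>S\<close> satisfies
  \<open>x * S * p j \<le> (j + h + 1) * p (j + h + 1)\<close>. Since \<open>j \<le> c\<close>, one
  test serves every \<open>m\<close> from \<open>h + 1\<close> to \<open>c + 2\<close>.\<close>

definition growth_ok :: "nat \<Rightarrow> nat \<Rightarrow> bool" where
  "growth_ok c h \<longleftrightarrow>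
     2 * int (c + 2) ^ 2 * int (c + Suc h) \<le> (\<Sum>(a, b)\<leftarrow>zip sigma2_list (growth c h). a * b)"

section \<open>Soundness of the coefficient arithmetic\<close>

abbreviation ev :: "real \<Rightarrow> int list \<Rightarrow> real" where
  "ev y xs \<equiv> horner_sum real_of_int y xs"

lemma ev_list_add: "ev y (list_add xs ys) = ev y xs + ev y ys"
  by (induction xs ys rule: list_add.induct) (simp_all add: algebra_simps)

lemma ev_list_scale: "ev y (list_scale c xs) = real_of_int c * ev y xs"
  by (induction xs) (simp_all add: algebra_simps)

lemma ev_mult_x: "ev y (mult_x xs) = (y + 2) * ev y xs"
  by (simp add: mult_x_def ev_list_add ev_list_scale algebra_simps)

lemma ev_lin_comb:
  "ev y (lin_comb cs xss) =
     (\<Sum>i<min (length cs) (length xss). real_of_int (cs ! i) * ev y (xss ! i))"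
  by (induction cs xss rule: lin_comb.induct)
     (simp_all add: ev_list_add ev_list_scale sum.lessThan_Suc_shift del: sum.lessThan_Suc)

lemma ev_nonneg: "y \<ge> 0 \<Longrightarrow> list_all (\<lambda>c. 0 \<le> c) xs \<Longrightarrow> ev y xs \<ge> 0"
  by (induction xs) simp_all

lemma ev_pos: "y \<ge> 0 \<Longrightarrow> list_pos xs \<Longrightarrow> ev y xs > 0"
  by (cases xs) (auto intro!: add_pos_nonneg mult_nonneg_nonneg ev_nonneg)

text \<open>The nested factors \<open>m * (m - 1) * ...\<close> in front of row \<open>i\<close>,
  times its own \<open>(m - i)!\<close>, give \<open>m!\<close>.\<close>

lemma ev_falling_comb:
  assumes "length xss = Suc m" "m < length cs"
    and "\<And>i. i \<le> m \<Longrightarrow> ev y (xss ! i) = fact (m - i) * f (m - i)"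
  shows "ev y (falling_comb (int m) cs xss) = fact m * (\<Sum>i\<le>m. real_of_int (cs ! i) * f (m - i))"
  using assms
proof (induction m arbitrary: cs xss)
  case 0
  then obtain c cs' xs where "cs = c # cs'" "xss = [xs]"
    by (cases cs; cases xss) auto
  with 0 show ?case by (simp add: ev_list_add ev_list_scale)
next
  case (Suc m)
  then obtain c cs' xs xss' where *: "cs = c # cs'" "xss = xs # xss'"
    by (cases cs; cases xss) auto
  have "ev y (falling_comb (int m) cs' xss')
      = fact m * (\<Sum>i\<le>m. real_of_int (cs' ! i) * f (m - i))"
    using Suc.prems * by (intro Suc.IH) (force dest: Suc.prems(3)[of "Suc _"])+
  then show ?case
    using Suc.prems(3)[of 0] *
    by (simp add: ev_list_add ev_list_scale sum.atMost_Suc_shift algebra_simps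
             del: sum.atMost_Suc)
qed

lemma length_fact_P_rows: "length (fact_P_rows n) = Suc n"
  by (induction n) (simp_all add: add_row_def)

lemma length_rescale: "length (rescale c m xss) = length xss"
  by (induction c m xss rule: rescale.induct) simp_all

lemma ev_fact_P_rows:
  assumes "i \<le> n" "n \<le> 30"
  shows "ev y (fact_P_rows n ! i) = fact (n - i) * poly (P (n - i)) (y + 2)"
  using assms
proof (induction n arbitrary: i)
  case (Suc n)
  show ?case
  proof (cases i)
    case 0
    have "(\<Sum>i\<le>n. real_of_int (sigma2_list ! i) * poly (P (n - i)) (y + 2))
        = (\<Sum>k=1..Suc n. real (sigma2 k) * poly (P (Suc n - k)) (y + 2))"
      using Suc.prems
      by (intro sum.reindex_bij_witness[of _ "\<lambda>k. k - 1" Suc]) (auto simp: sigma2_list_nth)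
    then have "ev y (falling_comb (int n) sigma2_list (fact_P_rows n))
        = fact n * (\<Sum>k=1..Suc n. real (sigma2 k) * poly (P (Suc n - k)) (y + 2))"
      using Suc by (subst ev_falling_comb) (auto simp: length_fact_P_rows length_sigma2_list)
    moreover have "poly (P (Suc n)) (y + 2) = (y + 2) / real (Suc n)
        * (\<Sum>k=1..Suc n. real (sigma2 k) * poly (P (Suc n - k)) (y + 2))"
      by (rule poly_P_rec) simp
    ultimately show ?thesis
      using 0 by (simp add: add_row_def ev_mult_x field_simps del: sum.cl_ivl_Suc of_nat_Suc)
  next
    case (Suc i')
    then show ?thesis using Suc.IH[of i'] Suc.prems by (simp add: add_row_def)
  qed
qed simp

text \<open>The product \<open>c * n!\<close> is invariant along the list: each row passed moves one
  factor from the factorial into \<open>c\<close>.\<close>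

lemma ev_rescale_fact_P_rows:
  assumes "real_of_int c * fact n = K" "i \<le> n" "n \<le> 30"
  shows "ev y (rescale c (int n) (fact_P_rows n) ! i) = K * poly (P (n - i)) (y + 2)"
  using assms
proof (induction n arbitrary: c i)
  case (Suc n)
  show ?case
  proof (cases i)
    case 0
    then show ?thesis
      using ev_fact_P_rows[of 0 "Suc n" y] Suc.prems
      by (simp add: add_row_def ev_list_scale mult_ac)
  next
    case (Suc i')
    then show ?thesis
      using Suc.IH[of "c * int (Suc n)" i'] Suc.prems by (simp add: add_row_def mult_ac)
  qed
qed (simp add: ev_list_scale)

lemma length_P_table: "length P_table = 23"
  by (simp add: P_table_def length_rescale length_fact_P_rows del: fact_P_rows.simps)

lemma ev_P_table: "n \<le> 22 \<Longrightarrow> ev y (P_table ! n) = fact 22 * poly (P n) (y + 2)"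
  using ev_rescale_fact_P_rows[of 1 22 "fact 22" "22 - n" y]
  by (simp add: P_table_def rev_nth length_rescale length_fact_P_rows
           del: fact_P_rows.simps fact_numeral)

text \<open>The number is \<open>22!\<close>.\<close>
lemma check_P_table: "check_all 1124000727777607680000 P_table"
  by code_simp

text \<open>The ranges \<open>h + 1 \<le> m \<le> c + 2\<close> are 13 to 14, 15 to 18, 19 to 29 and
  30 to 72, which reaches past 42, where \<open>p_growth_large\<close> begins.\<close>

lemma growth_checks: "growth_ok 12 12" "growth_ok 16 14" "growth_ok 27 18" "growth_ok 70 29"
  by code_simp+

definition gap :: "real \<Rightarrow> nat \<Rightarrow> nat \<Rightarrow> real" where
  "gap x n b = real b * poly (P n) x - x * (\<Sum>j<b. real (sigma2 (n - j)) * poly (P j) x)"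

definition excess_one :: "real \<Rightarrow> nat \<Rightarrow> real" where
  "excess_one x i = x * poly (P i) x - poly (P (Suc i)) x"

lemma ev_excess_one_coeffs: "i < 22 \<Longrightarrow> ev y (excess_one_coeffs P_table i) = fact 22 * excess_one (y + 2) i"
  by (simp add: excess_one_coeffs_def excess_one_def ev_list_add ev_list_scale ev_mult_x ev_P_table algebra_simps
           del: fact_numeral)

lemma nth_rev_take_sigma2_list:
  assumes "j < n" "n \<le> 30"
  shows "rev (take n sigma2_list) ! j = int (sigma2 (n - j))"
  using assms by (simp add: rev_nth length_sigma2_list sigma2_list_nth Suc_diff_Suc)

lemma ev_gap_coeffs:
  assumes "b \<le> n" "n \<le> 22"
  shows "ev y (gap_coeffs P_table n b) = fact 22 * gap (y + 2) n b"
proof -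
  have "ev y (lin_comb (take b (rev (take n sigma2_list))) P_table)
      = (\<Sum>j<b. real (sigma2 (n - j)) * (fact 22 * poly (P j) (y + 2)))"
    using assms
    by (simp add: ev_lin_comb length_sigma2_list length_P_table nth_rev_take_sigma2_list ev_P_table)
  also have "\<dots> = fact 22 * (\<Sum>j<b. real (sigma2 (n - j)) * poly (P j) (y + 2))"
    by (simp add: sum_distrib_left mult.left_commute)
  finally show ?thesis
    using assms
    by (simp add: gap_coeffs_def gap_def ev_list_add ev_list_scale ev_mult_x ev_P_table algebra_simps)
qed

section \<open>Growth of the values\<close>

context
  fixes x :: real
  assumes x_ge_2: "x \<ge> 2"
begin

abbreviation p :: "nat \<Rightarrow> real" where "p n \<equiv> poly (P n) x"

abbreviation s :: "nat \<Rightarrow> real" where "s n \<equiv> real (sigma2 n)"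

lemma p_rec: "real n * p n = x * (\<Sum>k=1..n. s k * p (n - k))"
proof (cases "n = 0")
  case False
  then have "p n = x / real n * (\<Sum>k=1..n. s k * p (n - k))"
    by (intro poly_P_rec) simp
  with False show ?thesis by simp
qed simp

lemma p_rec': "real n * p n = x * (\<Sum>i<n. s (n - i) * p i)"
proof -
  have "(\<Sum>k=1..n. s k * p (n - k)) = (\<Sum>i<n. s (n - i) * p i)"
    by (rule sum.reindex_bij_witness[of _ "\<lambda>i. n - i" "\<lambda>k. n - k"]) auto
  then show ?thesis by (simp only: p_rec)
qed

lemma p_0: "p 0 = 1" by simp

lemma p_1: "p 1 = x"
proof -
  have "sigma2 1 = 1" by (simp add: sigma2_def)
  then show ?thesis using p_rec[of 1] by simp
qed

lemma s_ge_1: "n \<ge> 1 \<Longrightarrow> s n \<ge> 1"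
  using sigma2_ge_square[of n] one_le_power[of n 2] by linarith

text \<open>
  The differences are the coefficients of the generating function multiplied by \<open>1 - q\<close>,
  whose logarithmic derivative still has nonnegative coefficients.
\<close>
lemma p_diff_nonneg: "p n - (if n = 0 then 0 else p (n - 1)) \<ge> 0"
proof (induction n rule: less_induct)
  case (less n)
  define q where "q = (\<lambda>n. p n - (if n = 0 then 0 else p (n - 1)))"
  show ?case
  proof (cases n)
    case (Suc m)
    have sum_q: "(\<Sum>i<k. q i) = (if k = 0 then 0 else p (k - 1))" for k
      by (induction k) (auto simp: q_def)
    have "(\<Sum>i<n. s (n - i) * (if i = 0 then 0 else p (i - 1))) = (\<Sum>i<m. s (m - i) * p i)"
      unfolding Suc by (subst sum.lessThan_Suc_shift) simp
    then have "x * (\<Sum>i<n. s (n - i) * q i) = n * p n - m * p m"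
      unfolding q_def p_rec' by (simp add: right_diff_distrib sum_subtractf)
    moreover have "(\<Sum>i<n. (x * s (n - i) - 1) * q i) = x * (\<Sum>i<n. s (n - i) * q i) - p m"
      using Suc sum_q[of n]
      by (simp only: left_diff_distrib sum_subtractf sum_distrib_left mult.assoc mult_1) simp
    ultimately have "(\<Sum>i<n. (x * s (n - i) - 1) * q i) = real n * q n"
      using Suc by (simp add: q_def algebra_simps)
    moreover have "(\<Sum>i<n. (x * s (n - i) - 1) * q i) \<ge> 0"
    proof (intro sum_nonneg mult_nonneg_nonneg)
      fix i assume "i \<in> {..<n}"
      then have "s (n - i) \<ge> 1" by (intro s_ge_1) auto
      then have "2 * 1 \<le> x * s (n - i)" using x_ge_2 by (intro mult_mono) auto
      then show "0 \<le> x * s (n - i) - 1" by simp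
      show "0 \<le> q i" using less.IH \<open>i \<in> {..<n}\<close> by (simp add: q_def)
    qed
    ultimately have "q n \<ge> 0" using Suc by (simp add: zero_le_mult_iff)
    then show ?thesis by (simp add: q_def)
  qed simp
qed

lemma p_mono: "m \<le> n \<Longrightarrow> p m \<le> p n"
proof (rule lift_Suc_mono_le[of p])
  show "p k \<le> p (Suc k)" for k using p_diff_nonneg[of "Suc k"] by simp
qed

lemma p_ge_1: "p n \<ge> 1"
  using p_mono[of 0 n] by simp

lemma p_shift_rec:
  "x * (\<Sum>i<h. s (h - i) * p (j + i)) \<le> real (j + h) * p (j + h)"
proof -
  have "(\<Sum>i<h. s (h - i) * p (j + i)) = (\<Sum>i=j..<j+h. s (j + h - i) * p i)"
    by (rule sum.reindex_bij_witness[of _ "\<lambda>i. i - j" "\<lambda>i. j + i"]) auto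
  also have "\<dots> \<le> (\<Sum>i<j+h. s (j + h - i) * p i)"
    using order_trans[OF zero_le_one p_ge_1] by (intro sum_mono2) auto
  finally show ?thesis
    unfolding p_rec' using x_ge_2 by (intro mult_left_mono) auto
qed

lemma sum_squares_le_s: "real h * (real h + 1) * (2 * real h + 1) / 6 \<le> (\<Sum>i<h. s (h - i))"
proof -
  have "(\<Sum>i<h. s (h - i)) = (\<Sum>k=1..h. s k)"
    by (rule sum.reindex_bij_witness[of _ "\<lambda>k. h - k" "\<lambda>i. h - i"]) auto
  also have "\<dots> \<ge> (\<Sum>k=1..h. real k ^ 2)"
    by (intro sum_mono) (metis atLeastAtMost_iff of_nat_mono of_nat_power sigma2_ge_square)
  also have "(\<Sum>k=1..h. real k ^ 2) = real h * (real h + 1) * (2 * real h + 1) / 6"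
    by (induction h) (auto simp: field_simps power2_eq_square)
  finally show ?thesis .
qed

lemma p_growth_step:
  "x * (real h * (real h + 1) * (2 * real h + 1) / 6) * p j \<le> real (j + h) * p (j + h)"
proof -
  have "real h * (real h + 1) * (2 * real h + 1) / 6 * p j \<le> (\<Sum>i<h. s (h - i)) * p j"
    using p_ge_1[of j] by (intro mult_right_mono sum_squares_le_s) auto
  also have "\<dots> \<le> (\<Sum>i<h. s (h - i) * p (j + i))"
    unfolding sum_distrib_right by (intro sum_mono mult_left_mono p_mono) auto
  finally have "x * (real h * (real h + 1) * (2 * real h + 1) / 6 * p j)
      \<le> x * (\<Sum>i<h. s (h - i) * p (j + i))"
    using x_ge_2 by (intro mult_left_mono) auto
  with p_shift_rec[of h j] show ?thesis by (simp add: mult.assoc)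
qed

text \<open>
  One step of \<open>p_growth_step\<close> gains only a factor of order \<open>x * m\<^sup>2 / 6\<close>; two steps of length
  about \<open>m / 2\<close> gain order \<open>x\<^sup>2 * m ^ 4 / 1728\<close>.
\<close>
lemma p_growth_large:
  assumes "m \<ge> 42" "j + 2 \<le> m"
  shows "2 * x * real m ^ 2 * p j \<le> p (j + m)"
proof -
  define h where "h = m div 2"
  define k where "k = m - h"
  have hk: "m = h + k" "real h \<ge> (real m - 1) / 2" "real k \<ge> (real m - 1) / 2" "real h \<le> real m / 2"
    unfolding h_def k_def by (auto simp: of_nat_diff field_simps)
  \<comment> \<open>The value of \<open>h * (h + 1) * (2 * h + 1) / 6\<close> at
    \<open>h = (m - 1) / 2\<close>.\<close>
  define c where "c = real m * (real m ^ 2 - 1) / 24"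
  have c_nonneg: "c \<ge> 0"
    using assms(1) by (auto simp: c_def intro!: mult_nonneg_nonneg one_le_power)
  have c: "c \<le> real i * (real i + 1) * (2 * real i + 1) / 6" if "real i \<ge> (real m - 1) / 2" for i
  proof -
    have "(real m - 1) / 2 * ((real m - 1) / 2 + 1) * (2 * ((real m - 1) / 2) + 1)
        \<le> real i * (real i + 1) * (2 * real i + 1)"
      using that assms(1) by (intro mult_mono) auto
    then show ?thesis by (simp add: c_def field_simps power2_eq_square)
  qed
  have step: "x * c * p i \<le> u * p (i + l)"
    if "real l \<ge> (real m - 1) / 2" "real (i + l) \<le> u" for i l u
  proof -
    have "x * c * p i \<le> x * (real l * (real l + 1) * (2 * real l + 1) / 6) * p i"
      using c[OF that(1)] x_ge_2 p_ge_1[of i] by (intro mult_right_mono mult_left_mono) auto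
    also have "\<dots> \<le> real (i + l) * p (i + l)" by (rule p_growth_step)
    also have "\<dots> \<le> u * p (i + l)" using that(2) p_ge_1[of "i + l"] by (intro mult_right_mono) auto
    finally show ?thesis .
  qed
  have one: "x * c * p j \<le> 3 / 2 * real m * p (j + h)"
    by (rule step) (use hk assms in auto)
  have two: "x * c * p (j + h) \<le> 2 * real m * p (j + h + k)"
    by (rule step) (use hk assms in auto)
  have "(x * c) * (x * c * p j) \<le> (x * c) * (3 / 2 * real m * p (j + h))"
    using one c_nonneg x_ge_2 by (intro mult_left_mono) auto
  also have "\<dots> = 3 / 2 * real m * (x * c * p (j + h))" by simp
  also have "\<dots> \<le> 3 / 2 * real m * (2 * real m * p (j + m))"
    using two hk(1) by (intro mult_left_mono) (auto simp: add.assoc)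
  finally have *: "x ^ 2 * c ^ 2 * p j \<le> 3 * real m ^ 2 * p (j + m)"
    by (simp add: power2_eq_square mult_ac)
  \<comment> \<open>Here \<open>1764 = 42 ^ 2\<close>, while \<open>1728 = 3 * 24 ^ 2\<close> is
    what \<open>3 * m ^ 4 \<le> c ^ 2\<close> requires.\<close>
  have "1764 \<le> real m ^ 2" using assms(1) power_mono[of 42 "real m" 2] by simp
  then have "1764 * real m ^ 2 \<le> real m ^ 2 * real m ^ 2"
    by (intro mult_right_mono) auto
  moreover have "(real m ^ 2 - 1) ^ 2 = real m ^ 2 * real m ^ 2 - 2 * real m ^ 2 + 1"
    by (simp add: power2_eq_square algebra_simps)
  ultimately have "1728 * real m ^ 2 \<le> (real m ^ 2 - 1) ^ 2"
    using zero_le_power2[of "real m"] by linarith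
  then have "real m ^ 2 * (1728 * real m ^ 2) \<le> real m ^ 2 * (real m ^ 2 - 1) ^ 2"
    by (intro mult_left_mono) auto
  then have "3 * real m ^ 4 \<le> c ^ 2"
    by (simp add: c_def power_mult_distrib power_divide eval_nat_numeral mult_ac)
  moreover have "2 * x \<le> x ^ 2" using x_ge_2 by (simp add: power2_eq_square)
  ultimately have "(2 * x) * (3 * real m ^ 4) * p j \<le> x ^ 2 * c ^ 2 * p j"
    using p_ge_1[of j] x_ge_2 by (intro mult_right_mono mult_mono) auto
  also note *
  finally have "3 * real m ^ 2 * (2 * x * real m ^ 2 * p j) \<le> 3 * real m ^ 2 * p (j + m)"
    by (simp add: eval_nat_numeral mult_ac)
  then show ?thesis
    using assms(1) by (subst (asm) mult_le_cancel_left_pos) auto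
qed

section \<open>Growth bounds from the computed tables\<close>

lemma growth_dot:
  assumes "length l = h" "h \<le> 30" "\<And>i. i < h \<Longrightarrow> real_of_int (l ! i) * p j \<le> p (j + (h - 1 - i))"
  shows "x * real_of_int (\<Sum>(a, b)\<leftarrow>zip sigma2_list l. a * b) * p j \<le> real (j + h) * p (j + h)"
proof -
  have "(\<Sum>(a, b)\<leftarrow>zip sigma2_list l. a * b) = (\<Sum>i<h. int (sigma2 (Suc i)) * l ! i)"
    using assms(1,2)
    by (simp add: sum_list_sum_nth length_sigma2_list sigma2_list_nth lessThan_atLeast0)
  then have "x * real_of_int (\<Sum>(a, b)\<leftarrow>zip sigma2_list l. a * b) * p j
      = x * (\<Sum>i<h. s (Suc i) * (real_of_int (l ! i) * p j))"
    by (simp add: sum_distrib_right mult.assoc)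
  also have "\<dots> \<le> x * (\<Sum>i<h. s (Suc i) * p (j + (h - 1 - i)))"
    using x_ge_2 assms(3) by (intro mult_left_mono sum_mono) auto
  also have "(\<Sum>i<h. s (Suc i) * p (j + (h - 1 - i))) = (\<Sum>i<h. s (h - i) * p (j + i))"
    by (rule sum.reindex_bij_witness[of _ "\<lambda>i. h - 1 - i" "\<lambda>i. h - 1 - i"]) auto
  also have "x * \<dots> \<le> real (j + h) * p (j + h)"
    by (rule p_shift_rec)
  finally show ?thesis .
qed

lemma length_growth: "length (growth c h) = Suc h"
  by (induction h) (auto simp: add_growth_def)

text \<open>Rounding down only weakens the bound, and the lower limit 1 in each entry is the
  monotonicity of \<open>p\<close>.\<close>

lemma growth_bound:
  assumes "j \<le> c" "h \<le> 30" "i \<le> h"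
  shows "real_of_int (growth c h ! i) * p j \<le> p (j + (h - i))"
  using assms(2,3)
proof (induction h arbitrary: i)
  case (Suc h)
  define S where "S = (\<Sum>(a, b)\<leftarrow>zip sigma2_list (growth c h). a * b)"
  define d where "d = int (c + Suc h)"
  show ?case
  proof (cases i)
    case 0
    have pj: "p j > 0" using p_ge_1[of j] by simp
    have dot: "x * real_of_int S * p j \<le> real (j + Suc h) * p (j + Suc h)"
      unfolding S_def using Suc by (intro growth_dot) (auto simp: length_growth)
    also have "\<dots> \<le> real_of_int d * p (j + Suc h)"
      using assms(1) p_ge_1[of "j + Suc h"] by (intro mult_right_mono) (auto simp: d_def)
    finally have *: "x * real_of_int S * p j \<le> real_of_int d * p (j + Suc h)" .
    have d: "d > 0" by (simp add: d_def)
    have "real_of_int (2 * S div d) * p j \<le> p (j + Suc h)"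
    \<comment> \<open>Replacing \<open>x\<close> by 2 uses \<open>S \<ge> 0\<close>; for negative
      \<open>S\<close> the quotient is nonpositive and the bound is trivial.\<close>
    proof (cases "S \<ge> 0")
      case True
      have "real_of_int (2 * S div d) \<le> real_of_int (2 * S) / real_of_int d"
        by (rule real_of_int_div4)
      then have "real_of_int (2 * S div d) * p j \<le> real_of_int (2 * S) / real_of_int d * p j"
        using pj by (intro mult_right_mono) auto
      also have "\<dots> = (2 * real_of_int S * p j) / real_of_int d" by simp
      also have "\<dots> \<le> (x * real_of_int S * p j) / real_of_int d"
        using d True x_ge_2 pj by (intro divide_right_mono mult_right_mono) auto
      also have "\<dots> \<le> p (j + Suc h)" using * d by (simp add: field_simps)
      finally show ?thesis .
    next
      case False
      then have "2 * S div d \<le> 0" using d by (simp add: div_nonpos_pos_le0)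
      then have "real_of_int (2 * S div d) * p j \<le> 0"
        using pj by (intro mult_nonpos_nonneg) auto
      then show ?thesis using p_ge_1[of "j + Suc h"] by linarith
    qed
    moreover have "1 * p j \<le> p (j + Suc h)" using p_mono[of j "j + Suc h"] by simp
    ultimately have "real_of_int (max 1 (2 * S div d)) * p j \<le> p (j + Suc h)"
      by (simp only: max_def of_int_1 split: if_split) blast
    then show ?thesis using 0 by (simp add: S_def d_def add_growth_def)
  next
    case (Suc i')
    then show ?thesis using Suc.IH[of i'] Suc.prems by (simp add: add_growth_def)
  qed
qed (simp add: p_0)

text \<open>The table bounds \<open>p (j + h + 1)\<close>; monotonicity extends this to
  \<open>p (j + m)\<close>.\<close>

lemma p_growth_block:
  assumes "growth_ok c h" "h < 30" "Suc h \<le> m" "m \<le> c + 2" "j + 2 \<le> m"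
  shows "2 * x * real m ^ 2 * p j \<le> p (j + m)"
proof -
  define S where "S = (\<Sum>(a, b)\<leftarrow>zip sigma2_list (growth c h). a * b)"
  define d where "d = real (c + Suc h)"
  have pj: "p j > 0" using p_ge_1[of j] by simp
  have "2 * real (c + 2) ^ 2 * d \<le> real_of_int S"
    using assms(1) unfolding growth_ok_def S_def[symmetric] d_def
    by (metis (mono_tags, lifting) of_int_le_iff of_int_mult of_int_numeral of_int_of_nat_eq of_int_power)
  moreover have "2 * real m ^ 2 * d \<le> 2 * real (c + 2) ^ 2 * d"
    using assms by (intro mult_right_mono mult_left_mono power_mono) (auto simp: d_def)
  ultimately have "x * (2 * real m ^ 2 * d) * p j \<le> x * real_of_int S * p j"
    using x_ge_2 pj by (intro mult_right_mono mult_left_mono) auto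
  also have "\<dots> \<le> real (j + Suc h) * p (j + Suc h)"
    unfolding S_def using assms growth_bound[of j c h]
    by (intro growth_dot) (auto simp: length_growth)
  also have "\<dots> \<le> d * p (j + m)"
    using assms p_mono[of "j + Suc h" "j + m"] p_ge_1[of "j + Suc h"]
    by (intro mult_mono) (auto simp: d_def)
  finally have "d * (2 * x * real m ^ 2 * p j) \<le> d * p (j + m)" by (simp add: mult_ac)
  then show ?thesis by (simp add: d_def)
qed

section \<open>Positivity of the gap\<close>

lemma gap_small_ge2:
  assumes "4 \<le> n" "n \<le> 22" "2 \<le> b" "2 * b \<le> n"
  shows "0 < gap x n b + x * (s (n - b - 1) * excess_one x b)"
proof -
  have "n \<in> {4..<23}" "b \<in> {2..<Suc (n div 2)}" using assms by auto
  then have "check_ge2 P_table n b"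
    using check_P_table unfolding check_all_def list_all_iff set_upt by blast
  then have "0 < ev (x - 2) (list_add (gap_coeffs P_table n b)
      (mult_x (list_scale (sigma2_list ! (n - b - 2)) (excess_one_coeffs P_table b))))"
    unfolding check_ge2_def using x_ge_2 by (intro ev_pos) auto
  also have "\<dots> = fact 22 * (gap x n b + x * (s (n - b - 1) * excess_one x b))"
  proof -
    have "Suc (n - b - 2) = n - b - 1" using assms by simp
    then show ?thesis
      using assms by (simp add: ev_list_add ev_mult_x ev_list_scale ev_gap_coeffs ev_excess_one_coeffs sigma2_list_nth
          distrib_left mult_ac del: fact_numeral)
  qed
  finally show ?thesis by (simp only: zero_less_mult_iff) simp
qed

lemma gap_small_1:
  assumes "12 \<le> n" "n \<le> 22"
  shows "0 < gap x n 1 + x * (\<Sum>i=1..10. s (n - 1 - i) * excess_one x i)"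
proof -
  have "n \<in> {12..<23}" using assms by auto
  then have "check_1 P_table n"
    using check_P_table unfolding check_all_def list_all_iff set_upt by blast
  then have "0 < ev (x - 2) (list_add (gap_coeffs P_table n 1)
      (mult_x (lin_comb (take 10 (rev (take (n - 2) sigma2_list))) (map (excess_one_coeffs P_table) [1..<11]))))"
    unfolding check_1_def using x_ge_2 by (intro ev_pos) auto
  also have "\<dots> = fact 22 * gap x n 1
      + x * (\<Sum>i<10. s (n - 2 - i) * (fact 22 * excess_one x (Suc i)))"
    using assms
    by (simp add: ev_list_add ev_mult_x ev_gap_coeffs ev_lin_comb length_sigma2_list
        nth_rev_take_sigma2_list ev_excess_one_coeffs del: fact_numeral upt_rec_numeral sum.lessThan_Suc)
  also have "(\<Sum>i<10. s (n - 2 - i) * (fact 22 * excess_one x (Suc i)))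
      = (\<Sum>i=1..10. s (n - 1 - i) * (fact 22 * excess_one x i))"
    by (rule sum.reindex_bij_witness[of _ "\<lambda>i. i - 1" Suc]) auto
  also have "fact 22 * gap x n 1 + x * \<dots>
      = fact 22 * (gap x n 1 + x * (\<Sum>i=1..10. s (n - 1 - i) * excess_one x i))"
    by (simp only: sum_distrib_left distrib_left mult.left_commute)
  finally show ?thesis by (simp only: zero_less_mult_iff) simp
qed

text \<open>The constant is sharp, with equality at \<open>x = 2\<close>, \<open>i = 9\<close>. In
  the check, \<open>180 + 90 * y\<close> is \<open>90 * x\<close>.\<close>

lemma excess_one_lower_bound:
  assumes "1 \<le> i" "i \<le> 10"
  shows "excess_one x i \<ge> - 90 * x"
proof -
  have "i \<in> {1..<11}" using assms by auto
  then have "list_all (\<lambda>a. 0 \<le> a)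
      (list_add (excess_one_coeffs P_table i) [180 * 1124000727777607680000, 90 * 1124000727777607680000])"
    using check_P_table unfolding check_all_def list_all_iff[of _ "[1..<11]"] set_upt by blast
  then have "0 \<le> ev (x - 2)
      (list_add (excess_one_coeffs P_table i) [180 * 1124000727777607680000, 90 * 1124000727777607680000])"
    using x_ge_2 by (intro ev_nonneg) auto
  also have "\<dots> = fact 22 * (excess_one x i + 90 * x)"
    using assms by (simp add: ev_list_add ev_excess_one_coeffs distrib_left del: fact_numeral) (simp add: fact_numeral)
  finally have "0 \<le> excess_one x i + 90 * x"
    using fact_gt_zero[of 22, where ?'a = real] by (simp only: zero_le_mult_iff) linarith
  then show ?thesis by simp
qed

text \<open>Equality holds at \<open>x = 2\<close>, where \<open>p 10 = 5380\<close>.\<close>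

lemma p_10_lower_bound: "p 10 \<ge> 2690 * x"
proof -
  have "list_all (\<lambda>a. 0 \<le> a) (list_add (P_table ! 10)
      [- 5380 * 1124000727777607680000, - 2690 * 1124000727777607680000])"
    using check_P_table unfolding check_all_def by blast
  then have "0 \<le> ev (x - 2) (list_add (P_table ! 10)
      [- 5380 * 1124000727777607680000, - 2690 * 1124000727777607680000])"
    using x_ge_2 by (intro ev_nonneg) auto
  also have "\<dots> = fact 22 * (p 10 - 2690 * x)"
    by (simp add: ev_list_add ev_P_table right_diff_distrib del: fact_numeral) (simp add: fact_numeral)
  finally have "0 \<le> p 10 - 2690 * x"
    using fact_gt_zero[of 22, where ?'a = real] by (simp only: zero_le_mult_iff) linarith
  then show ?thesis by simp
qed

lemma p_growth:
  assumes "m \<ge> 13" "j + 2 \<le> m"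
  shows "2 * x * real m ^ 2 * p j \<le> p (j + m)"
proof -
  consider "m \<le> 14" | "15 \<le> m" "m \<le> 18" | "19 \<le> m" "m \<le> 29" | "30 \<le> m" "m \<le> 72" | "m \<ge> 42"
    by linarith
  then show ?thesis
  proof cases
    case 5
    then show ?thesis using assms(2) by (rule p_growth_large)
  qed (use assms growth_checks in \<open>auto intro: p_growth_block\<close>)
qed

text \<open>The gap is a sum over \<open>j < b\<close> of nonnegative terms, and the term
  \<open>j = 0\<close> alone exceeds the bound. The constant is \<open>10 * 2 * 90\<close>: ten
  terms, \<open>sigma2 m < 2 * m ^ 2\<close>, and \<open>excess_one\<close> at least
  \<open>- 90 * x\<close>.\<close>

lemma gap_large:
  assumes "23 \<le> n" "1 \<le> b" "2 * b \<le> n"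
  shows "gap x n b > x ^ 2 * 1800 * real (n - 2) ^ 2"
proof -
  have term_nonneg: "p n - x * (s (n - j) * p j) \<ge> 0" if "j < b" for j
  proof -
    have j: "13 \<le> n - j" "j + 2 \<le> n - j" "j + (n - j) = n" using that assms by auto
    have "x * s (n - j) * p j \<le> x * (2 * real (n - j) ^ 2) * p j"
      using sigma2_less[of "n - j"] j x_ge_2 p_ge_1[of j]
      by (intro mult_right_mono mult_left_mono) auto
    also have "\<dots> \<le> p n" using p_growth[OF j(1,2)] j(3) by (simp add: mult_ac)
    finally show ?thesis by (simp add: mult.assoc)
  qed
  \<comment> \<open>In terms of \<open>t\<close>, the quadratic inequality below has only positive
    coefficients after subtraction.\<close>
  obtain t where t: "n = 23 + t" using assms(1) le_Suc_ex by blast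
  have n: "13 \<le> n - 10" "10 + 2 \<le> n - 10" "10 + (n - 10) = n" using assms by auto
  have "x ^ 2 * (1800 * real (n - 2) ^ 2 + real n ^ 2) < x ^ 2 * (5380 * real (n - 10) ^ 2)"
    using x_ge_2 unfolding t
    by (intro mult_strict_left_mono)
       (auto simp: power2_eq_square algebra_simps intro!: add_pos_nonneg)
  also have "\<dots> = 2 * x * real (n - 10) ^ 2 * (2690 * x)" by (simp add: power2_eq_square)
  also have "\<dots> \<le> 2 * x * real (n - 10) ^ 2 * p 10"
    using x_ge_2 p_10_lower_bound by (intro mult_left_mono) auto
  also have "\<dots> \<le> p n" using p_growth[OF n(1,2)] n(3) by simp
  finally have pn: "x ^ 2 * 1800 * real (n - 2) ^ 2 + x ^ 2 * real n ^ 2 < p n"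
    by (simp add: distrib_left mult_ac)
  have "x * s n \<le> x * (2 * real n ^ 2)"
    using sigma2_less[of n] assms x_ge_2 by (intro mult_left_mono) auto
  also have "\<dots> \<le> x * (x * real n ^ 2)"
    using x_ge_2 by (intro mult_left_mono mult_right_mono) auto
  finally have "x ^ 2 * 1800 * real (n - 2) ^ 2 < p n - x * (s (n - 0) * p 0)"
    using pn by (simp add: power2_eq_square mult_ac)
  also have "\<dots> \<le> (\<Sum>j<b. p n - x * (s (n - j) * p j))"
    using assms(2) term_nonneg by (intro member_le_sum) auto
  also have "\<dots> = gap x n b"
    by (simp add: gap_def sum_subtractf sum_distrib_left)
  finally show ?thesis .
qed

lemma s_excess_one_lower_bound:
  assumes "1 \<le> i" "i \<le> 10" "1 \<le> m" "m \<le> k"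
  shows "- (180 * x * real k ^ 2) \<le> s m * excess_one x i"
proof -
  have "real m ^ 2 \<le> real k ^ 2" using assms by (intro power_mono) auto
  then have "s m \<le> 2 * real k ^ 2" using sigma2_less[of m] assms(3) by linarith
  then have "s m * (90 * x) \<le> 2 * real k ^ 2 * (90 * x)"
    using x_ge_2 by (intro mult_right_mono) auto
  moreover have "s m * (- 90 * x) \<le> s m * excess_one x i"
    using excess_one_lower_bound[of i] assms by (intro mult_left_mono) auto
  ultimately show ?thesis by (simp add: mult_ac)
qed

lemma gap_ge2:
  assumes "4 \<le> n" "2 \<le> b" "2 * b \<le> n" "b \<ge> 11 \<Longrightarrow> excess_one x b \<ge> 0"
  shows "0 < gap x n b + x * (s (n - b - 1) * excess_one x b)"
proof (cases "n \<le> 22")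
  case False
  have "0 \<le> x ^ 2 * 1800 * real (n - 2) ^ 2" by simp
  with gap_large[of n b] False assms
  have gaps: "gap x n b > x ^ 2 * 1800 * real (n - 2) ^ 2" "gap x n b > 0" by linarith+
  show ?thesis
  proof (cases "b \<le> 10")
    case True
    have "x * - (180 * x * real (n - 2) ^ 2) \<le> x * (s (n - b - 1) * excess_one x b)"
      using assms True False x_ge_2 by (intro mult_left_mono s_excess_one_lower_bound) auto
    moreover have "x * (180 * x * real (n - 2) ^ 2) \<le> x ^ 2 * 1800 * real (n - 2) ^ 2"
      using x_ge_2 by (simp add: power2_eq_square)
    ultimately show ?thesis using gaps(1) by simp
  next
    case b: False
    have "0 \<le> x * (s (n - b - 1) * excess_one x b)" using assms(4) b x_ge_2 by simp
    with gaps(2) show ?thesis by linarith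
  qed
qed (use assms gap_small_ge2 in auto)

lemma gap_1:
  assumes "12 \<le> n"
  shows "0 < gap x n 1 + x * (\<Sum>i=1..10. s (n - 1 - i) * excess_one x i)"
proof (cases "n \<le> 22")
  case False
  have "(\<Sum>i=1..10::nat. - (180 * x * real (n - 2) ^ 2))
      \<le> (\<Sum>i=1..10. s (n - 1 - i) * excess_one x i)"
    using False by (intro sum_mono s_excess_one_lower_bound) auto
  then have "x * (- 1800 * x * real (n - 2) ^ 2) \<le> x * (\<Sum>i=1..10. s (n - 1 - i) * excess_one x i)"
    using x_ge_2 by (intro mult_left_mono) auto
  moreover have "x * (- 1800 * x * real (n - 2) ^ 2) = - (x ^ 2 * 1800 * real (n - 2) ^ 2)"
    by (simp add: power2_eq_square)
  ultimately show ?thesis using gap_large[of n 1] False by linarith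
qed (use assms gap_small_1 in auto)

section \<open>The induction\<close>

text \<open>The recurrence sum for \<open>p (a + b)\<close> is split at index \<open>b\<close>: the
  lower part enters the gap, the upper part matches the sum for \<open>p a\<close>.\<close>

lemma excess_rec:
  "real a * (p a * p b - p (a + b)) =
     x * (\<Sum>i<a. s (a - i) * (p i * p b - p (i + b)))
     + (real b * p (a + b) - x * (\<Sum>j<b. s (a + b - j) * p j))"
proof -
  have "(\<Sum>i<a+b. s (a + b - i) * p i)
      = (\<Sum>j<b. s (a + b - j) * p j) + (\<Sum>i=b..<a+b. s (a + b - i) * p i)"
    by (simp add: lessThan_atLeast0 sum.atLeastLessThan_concat)
  also have "(\<Sum>i=b..<a+b. s (a + b - i) * p i) = (\<Sum>i<a. s (a - i) * p (i + b))"
    by (rule sum.reindex_bij_witness[of _ "\<lambda>i. i + b" "\<lambda>i. i - b"]) auto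
  finally have "real (a + b) * p (a + b)
      = x * (\<Sum>j<b. s (a + b - j) * p j) + x * (\<Sum>i<a. s (a - i) * p (i + b))"
    unfolding p_rec' by (simp add: distrib_left)
  moreover have "real a * p a * p b = x * (\<Sum>i<a. s (a - i) * (p i * p b))"
    unfolding p_rec' mult.assoc sum_distrib_right ..
  ultimately show ?thesis
    by (simp add: right_diff_distrib sum_subtractf algebra_simps)
qed

lemma product_gt:
  assumes "1 \<le> b" "b \<le> a" "2 \<le> b \<or> 12 \<le> a + b"
  shows "p (a + b) < p a * p b"
  using assms
proof (induction "a + b" arbitrary: a b rule: less_induct)
  case less
  define d where "d = (\<lambda>i. p i * p b - p (i + b))"
  \<comment> \<open>By the symmetry of \<open>D\<close>, the pair is swapped when
    \<open>i < b\<close>.\<close>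
  have IH: "d i > 0" if "1 \<le> i" "i < a" "2 \<le> i \<and> 2 \<le> b \<or> 12 \<le> i + b" for i
  proof (cases "b \<le> i")
    case True
    then show ?thesis using less.hyps[of i b] that less.prems by (auto simp: d_def)
  next
    case False
    then show ?thesis using less.hyps[of b i] that less.prems by (auto simp: d_def add.commute mult.commute)
  qed
  have d_0: "d 0 = 0" by (simp add: d_def)
  have rec: "real a * d a = x * (\<Sum>i<a. s (a - i) * d i) + gap x (a + b) b"
    unfolding d_def gap_def by (rule excess_rec)
  have "real a * d a > 0"
  proof (cases "b = 1")
    case True
    have d_excess: "d i = excess_one x i" for i
      using True by (simp only: d_def excess_one_def p_1) simp
    have "(\<Sum>i=1..10. s (a - i) * d i) \<le> (\<Sum>i<a. s (a - i) * d i)"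
    proof (rule sum_mono2)
      fix i assume i: "i \<in> {..<a} - {1..10}"
      \<comment> \<open>The term \<open>i = 0\<close> vanishes, and \<open>i \<ge> 11\<close> gives
        \<open>i + b \<ge> 12\<close>, so the induction hypothesis applies.\<close>
      then have "i = 0 \<or> 11 \<le> i" by auto
      then show "0 \<le> s (a - i) * d i" using IH[of i] i d_0 True by force
    qed (use less.prems True in auto)
    then have "x * (\<Sum>i=1..10. s (a - i) * d i) \<le> x * (\<Sum>i<a. s (a - i) * d i)"
      using x_ge_2 by (intro mult_left_mono) auto
    moreover have "0 < gap x (a + b) b + x * (\<Sum>i=1..10. s (a - i) * d i)"
      using gap_1[of "a + b"] less.prems True by (simp add: d_excess)
    ultimately show ?thesis using rec by linarith
  next
    case False
    have d_1: "d 1 = excess_one x b"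
      unfolding d_def excess_one_def p_1 by simp
    have "s (a - 1) * d 1 \<le> (\<Sum>i<a. s (a - i) * d i)"
    proof (rule member_le_sum)
      fix i assume "i \<in> {..<a} - {1}"
      then show "0 \<le> s (a - i) * d i"
        using IH[of i] d_0 False less.prems by (cases "i = 0") force+
    qed (use less.prems False in auto)
    then have "x * (s (a - 1) * d 1) \<le> x * (\<Sum>i<a. s (a - i) * d i)"
      using x_ge_2 by (intro mult_left_mono) auto
    \<comment> \<open>Here \<open>1 + b \<ge> 12\<close>, so the induction hypothesis covers
      \<open>D(1, b)\<close>.\<close>
    moreover have "excess_one x b \<ge> 0" if "b \<ge> 11"
      using IH[of 1] that less.prems d_1 by force
    then have "0 < gap x (a + b) b + x * (s (a - 1) * d 1)"
      using gap_ge2[of "a + b" b] less.prems False d_1 by simp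
    ultimately show ?thesis using rec by linarith
  qed
  then show ?case by (simp add: d_def zero_less_mult_iff)
qed

end

theorem theorem1p4:
  fixes x :: real and a b :: nat
  assumes "x \<ge> 2" and "a \<ge> 1" and "b \<ge> 1" and "a + b \<ge> 12"
  shows "poly (P a) x * poly (P b) x > poly (P (a + b)) x"
proof (cases "b \<le> a")
  case True
  then show ?thesis using product_gt[of x b a] assms by simp
next
  case False
  then show ?thesis using product_gt[of x a b] assms by (simp add: add.commute mult.commute)
qed

end
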